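(* Let $G$ be a finite group with identity $e$ and let $H=\{H_1,\dots,H_m\}$ be a collection of subgroups of $G$ such that $|G|=|H_i||H_j|$ for all $i\ne j$ and $H$ is a partition of $G$. Then: (i) $H$ is a non-disjoint GPSEDF with $\lambda_{i,j}=1$ for all $i\ne j$ (a non-disjoint PSEDF when all $|H_i|$ are equal); (ii) $H'=\{H_1\setminus\{e\},\dots,H_m\setminus\{e\}\}$ is a classical GEDF (a classical EDF when all $|H_i|$ are equal) which is not a classical GSEDF.
   Context: A family of subgroups of $G$ is a partition of $G$ if every non-identity element of $G$ belongs to exactly one subgroup in the family. For subsets $A,B$ of a multiplicatively written group $G$, $\Delta(A,B)$ denotes the multiset $\{ab^{-1}:a\in A,b\in B\}$ (one entry per pair); multiset unions count multiplicity. For a set $S$ and $\lambda\in\mathbb{N}$, $\lambda S$ is the multiset of $\lambda$ copies of $S$. Let $|G|=v$. Non-disjoint $(v,m,k_1,\dots,k_m)$-GPSEDF: sets $A_1,\dots,A_m$ in $G$, $|A_i|=k_i$, with $\Delta(A_i,A_j)=\lambda_{i,j}G$, $\lambda_{i,j}=k_ik_j/v$, for all $i\ne j$. Non-disjoint $(v,m,k,\lambda)$-PSEDF: the case of $m>1$ sets all of size $k$ with $\Delta(A_i,A_j)=\lambda G$ for all $i\neq j$. Classical $(v,m;k_1,\dots,k_m;\lambda)$-GEDF: pairwise disjoint sets $A_1,\dots,A_m$ with $|A_i|=k_i$ and $\bigcup_{i\ne j}\Delta(A_i,A_j)=\lambda(G\setminus\{e\})$ (union over ordered pairs). A classical EDF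 is a classical GEDF with all $k_i$ equal (and $m>1$). Classical $(v,m;k_1,\dots,k_m;\lambda_1,\dots,\lambda_m)$-GSEDF: pairwise disjoint sets with $|A_i|=k_i$ and, for each $i$, $\bigcup_{j\ne i}\Delta(A_i,A_j)=\lambda_i(G\setminus\{e\})$.
   Formalization: The collection is assumed to have m > 1 subgroups, and "not a classical GSEDF" is claimed only when every H_i is non-trivial; for H = {G} or H = {G,{e}} the family H' is a GSEDF with all λ_i = 0, so the original claim fails there. *)

theory Defs
  imports "HOL-Algebra.Algebra" "HOL-Library.Multiset" "HOL-Library.Disjoint_Sets"
begin

text \<open>Families \<open>A\<^sub>1, \<dots>, A\<^sub>m\<close> are functions on \<open>nat\<close>, of which only the values on \<open>{1..m}\<close>
  matter.\<close>

definition group_partition :: "('a, 'b) monoid_scheme \<Rightarrow> nat \<Rightarrow> (nat \<Rightarrow> 'a set) \<Rightarrow> bool" where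
  "group_partition G m H \<longleftrightarrow>
     (\<forall>i\<in>{1..m}. subgroup (H i) G) \<and>
     (\<forall>g\<in>carrier G - {\<one>\<^bsub>G\<^esub>}. \<exists>!i. i \<in> {1..m} \<and> g \<in> H i)"

text \<open>The multiset of all \<open>a b\<inverse>\<close>, one entry per pair. Since \<open>mset_set\<close> of an infinite set is empty,
  this is only meaningful for finite sets; the definitions below all require \<open>G\<close> to be finite.\<close>

definition Delta :: "('a, 'b) monoid_scheme \<Rightarrow> 'a set \<Rightarrow> 'a set \<Rightarrow> 'a multiset" where
  "Delta G A B = image_mset (\<lambda>(a, b). a \<otimes>\<^bsub>G\<^esub> inv\<^bsub>G\<^esub> b) (mset_set (A \<times> B))"

definition set_family ::
  "('a, 'b) monoid_scheme \<Rightarrow> nat \<Rightarrow> nat \<Rightarrow> (nat \<Rightarrow> nat) \<Rightarrow> (nat \<Rightarrow> 'a set) \<Rightarrow> bool" where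
  "set_family G v m k A \<longleftrightarrow>
     group G \<and> finite (carrier G) \<and> order G = v \<and>
     (\<forall>i\<in>{1..m}. A i \<subseteq> carrier G \<and> card (A i) = k i)"

text \<open>``Non-disjoint'' means that disjointness is not required.\<close>

definition nondisjoint_GPSEDF ::
  "('a, 'b) monoid_scheme \<Rightarrow> nat \<Rightarrow> nat \<Rightarrow> (nat \<Rightarrow> nat) \<Rightarrow> (nat \<Rightarrow> nat \<Rightarrow> nat)
     \<Rightarrow> (nat \<Rightarrow> 'a set) \<Rightarrow> bool" where
  "nondisjoint_GPSEDF G v m k l A \<longleftrightarrow>
     set_family G v m k A \<and>
     (\<forall>i\<in>{1..m}. \<forall>j\<in>{1..m}. i \<noteq> j \<longrightarrow>
        real (l i j) = real (k i) * real (k j) / real v \<and>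
        Delta G (A i) (A j) = repeat_mset (l i j) (mset_set (carrier G)))"

definition nondisjoint_PSEDF ::
  "('a, 'b) monoid_scheme \<Rightarrow> nat \<Rightarrow> nat \<Rightarrow> nat \<Rightarrow> nat \<Rightarrow> (nat \<Rightarrow> 'a set) \<Rightarrow> bool" where
  "nondisjoint_PSEDF G v m k l A \<longleftrightarrow>
     m > 1 \<and> set_family G v m (\<lambda>_. k) A \<and>
     (\<forall>i\<in>{1..m}. \<forall>j\<in>{1..m}. i \<noteq> j \<longrightarrow>
        Delta G (A i) (A j) = repeat_mset l (mset_set (carrier G)))"

definition classical_GEDF ::
  "('a, 'b) monoid_scheme \<Rightarrow> nat \<Rightarrow> nat \<Rightarrow> (nat \<Rightarrow> nat) \<Rightarrow> nat \<Rightarrow> (nat \<Rightarrow> 'a set) \<Rightarrow> bool" where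
  "classical_GEDF G v m k l A \<longleftrightarrow>
     set_family G v m k A \<and> disjoint_family_on A {1..m} \<and>
     (\<Sum>(i, j)\<in>{(i, j). i \<in> {1..m} \<and> j \<in> {1..m} \<and> i \<noteq> j}. Delta G (A i) (A j))
       = repeat_mset l (mset_set (carrier G - {\<one>\<^bsub>G\<^esub>}))"

definition classical_EDF ::
  "('a, 'b) monoid_scheme \<Rightarrow> nat \<Rightarrow> nat \<Rightarrow> nat \<Rightarrow> nat \<Rightarrow> (nat \<Rightarrow> 'a set) \<Rightarrow> bool" where
  "classical_EDF G v m k l A \<longleftrightarrow> m > 1 \<and> classical_GEDF G v m (\<lambda>_. k) l A"

definition classical_GSEDF ::
  "('a, 'b) monoid_scheme \<Rightarrow> nat \<Rightarrow> nat \<Rightarrow> (nat \<Rightarrow> nat) \<Rightarrow> (nat \<Rightarrow> nat)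
     \<Rightarrow> (nat \<Rightarrow> 'a set) \<Rightarrow> bool" where
  "classical_GSEDF G v m k l A \<longleftrightarrow>
     set_family G v m k A \<and> disjoint_family_on A {1..m} \<and>
     (\<forall>i\<in>{1..m}. (\<Sum>j\<in>{1..m} - {i}. Delta G (A i) (A j))
        = repeat_mset (l i) (mset_set (carrier G - {\<one>\<^bsub>G\<^esub>})))"

end

theory Submission
  imports Defs
begin

text \<open>Two distinct members $H_i, H_j$ of the partition meet trivially, so $(a, b) \mapsto ab^{-1}$ is
  injective on $H_i \times H_j$, and by counting it is a bijection onto $G$. Under this bijection the
  pairs with $a \neq e \neq b$ correspond to the elements outside $H_i \cup H_j$. A non-identity
  element lies in exactly one $H_r$, so it occurs once for each ordered pair of distinct indices
  different from $r$, which makes $(m-1)(m-2)$ occurrences. For fixed $i$, however, the elements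
  of $H_i \setminus \{e\}$ never occur in $\Delta(H_i \setminus \{e\}, H_j \setminus \{e\})$, whereas
  that multiset is nonempty.\<close>

context group
begin

text \<open>Rearranging \<open>a \<otimes> inv b = c \<otimes> inv d\<close> gives
  \<open>inv c \<otimes> a = inv d \<otimes> b\<close>, whose left side lies in \<open>H\<close> and
  right side in \<open>K\<close>; hence both sides are the identity.\<close>

lemma inj_on_mult_inv_subgroups:
  assumes H: "subgroup H G" and K: "subgroup K G" and int: "H \<inter> K = {\<one>}"
  shows "inj_on (\<lambda>(a, b). a \<otimes> inv b) (H \<times> K)"
proof (rule inj_onI, clarify)
  fix a b c d
  assume mem: "a \<in> H" "b \<in> K" "c \<in> H" "d \<in> K" and eq: "a \<otimes> inv b = c \<otimes> inv d"
  have car: "a \<in> carrier G" "b \<in> carrier G" "c \<in> carrier G" "d \<in> carrier G"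
    using mem H K by (auto dest: subgroup.mem_carrier)
  have "inv c \<otimes> a = inv c \<otimes> (a \<otimes> inv b) \<otimes> b"
    using car by (simp add: m_assoc)
  also have "\<dots> = inv d \<otimes> b"
    using car by (simp add: eq m_assoc[symmetric])
  finally have eq': "inv c \<otimes> a = inv d \<otimes> b" .
  moreover have "inv c \<otimes> a \<in> H" "inv d \<otimes> b \<in> K"
    using mem H K by (auto intro: subgroup.m_closed subgroup.m_inv_closed)
  ultimately have "inv c \<otimes> a = \<one>"
    using int by auto
  with eq' have "inv c \<otimes> a = \<one>" "inv d \<otimes> b = \<one>" by auto
  then show "a = c \<and> b = d"
    using car by (metis inv_equality inv_inv inv_closed)
qed

lemma image_mult_inv_subgroups:
  assumes fin: "finite (carrier G)"
    and H: "subgroup H G" and K: "subgroup K G" and int: "H \<inter> K = {\<one>}"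
    and card: "order G = card H * card K"
  shows "(\<lambda>(a, b). a \<otimes> inv b) ` (H \<times> K) = carrier G"
proof (rule card_subset_eq[OF fin])
  show "(\<lambda>(a, b). a \<otimes> inv b) ` (H \<times> K) \<subseteq> carrier G"
    using H K by (auto dest: subgroup.mem_carrier)
  show "card ((\<lambda>(a, b). a \<otimes> inv b) ` (H \<times> K)) = card (carrier G)"
    using card_image[OF inj_on_mult_inv_subgroups[OF H K int]] card
    by (simp add: order_def card_cartesian_product)
qed

text \<open>An element \<open>h\<close> of \<open>H\<close> is represented by the pair
  \<open>(h, \<one>)\<close> and an element \<open>x\<close> of \<open>K\<close> by
  \<open>(\<one>, inv x)\<close>. By injectivity there is no other representation, which forces a
  trivial coordinate.\<close>

lemma mult_inv_in_subgroups_iff: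
  assumes H: "subgroup H G" and K: "subgroup K G" and int: "H \<inter> K = {\<one>}"
    and a: "a \<in> H" and b: "b \<in> K"
  shows "a \<otimes> inv b \<in> H \<union> K \<longleftrightarrow> a = \<one> \<or> b = \<one>"
proof -
  note inj = inj_on_mult_inv_subgroups[OF H K int]
  have one: "\<one> \<in> H" "\<one> \<in> K"
    using H K by (simp_all add: subgroup.one_closed)
  have car: "a \<in> carrier G" "b \<in> carrier G"
    using a b H K by (auto dest: subgroup.mem_carrier)
  have "b = \<one>" if "a \<otimes> inv b \<in> H"
    using inj_onD[OF inj, of "(a, b)" "(a \<otimes> inv b, \<one>)"] that a b one car by simp
  moreover have "a = \<one>" if "a \<otimes> inv b \<in> K"
    using inj_onD[OF inj, of "(a, b)" "(\<one>, inv (a \<otimes> inv b))"] that a b one car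
      subgroup.m_inv_closed[OF K that] by simp
  moreover have "a \<otimes> inv b \<in> H" if "b = \<one>"
    using that a car by simp
  moreover have "a \<otimes> inv b \<in> K" if "a = \<one>"
    using that b car subgroup.m_inv_closed[OF K b] by simp
  ultimately show ?thesis by blast
qed

lemma Delta_complementary_subgroups:
  assumes "finite (carrier G)"
    and "subgroup H G" and "subgroup K G" and "H \<inter> K = {\<one>}"
    and "order G = card H * card K"
  shows "Delta G H K = mset_set (carrier G)"
  unfolding Delta_def
  using image_mset_mset_set[OF inj_on_mult_inv_subgroups] image_mult_inv_subgroups assms
  by metis

text \<open>Deleting the identity from both factors deletes exactly the pairs that represent
  elements of \<open>H \<union> K\<close>. The restricted map is still injective, so every remaining
  element keeps multiplicity 1.\<close>

lemma Delta_complementary_subgroups_minus_one: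
  assumes fin: "finite (carrier G)"
    and H: "subgroup H G" and K: "subgroup K G" and int: "H \<inter> K = {\<one>}"
    and card: "order G = card H * card K"
  shows "Delta G (H - {\<one>}) (K - {\<one>}) = mset_set (carrier G - (H \<union> K))"
proof -
  let ?f = "\<lambda>(a, b). a \<otimes> inv b"
  have "?f ` ((H - {\<one>}) \<times> (K - {\<one>})) = ?f ` (H \<times> K) - (H \<union> K)" (is "?L = ?R")
  proof (intro equalityI subsetI)
    fix x assume "x \<in> ?L"
    then obtain a b where "a \<in> H" "b \<in> K" "a \<noteq> \<one>" "b \<noteq> \<one>" "x = a \<otimes> inv b" by auto
    then show "x \<in> ?R"
      using mult_inv_in_subgroups_iff[OF H K int, of a b] by auto
  next
    fix x assume x: "x \<in> ?R"
    then obtain a b where ab: "a \<in> H" "b \<in> K" "x = a \<otimes> inv b" by auto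
    with x have "a \<noteq> \<one>" "b \<noteq> \<one>"
      using mult_inv_in_subgroups_iff[OF H K int, of a b] by blast+
    with ab show "x \<in> ?L" by auto
  qed
  also have "?R = carrier G - (H \<union> K)"
    using image_mult_inv_subgroups[OF assms] by simp
  finally have img: "?L = carrier G - (H \<union> K)" .
  have "inj_on ?f ((H - {\<one>}) \<times> (K - {\<one>}))"
    by (rule inj_on_subset[OF inj_on_mult_inv_subgroups[OF H K int]]) auto
  from image_mset_mset_set[OF this] img show ?thesis
    by (simp add: Delta_def)
qed

end

lemma card_off_diagonal:
  assumes "finite D"
  shows "card {(i, j). i \<in> D \<and> j \<in> D \<and> i \<noteq> j} = card D * (card D - 1)"
proof -
  have "{(i, j). i \<in> D \<and> j \<in> D \<and> i \<noteq> j} = (SIGMA i:D. D - {i})" by auto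
  then show ?thesis using assms by (simp add: card_SigmaI)
qed

theorem theorem4p12:
  fixes G :: "('a, 'b) monoid_scheme" and m :: nat and H :: "nat \<Rightarrow> 'a set"
  assumes "group G" and "finite (carrier G)"
    and "m > 1"
    and "\<And>i. i \<in> {1..m} \<Longrightarrow> subgroup (H i) G"
    and "\<And>i j. i \<in> {1..m} \<Longrightarrow> j \<in> {1..m} \<Longrightarrow> i \<noteq> j \<Longrightarrow> order G = card (H i) * card (H j)"
    and "group_partition G m H"
  shows "nondisjoint_GPSEDF G (order G) m (\<lambda>i. card (H i)) (\<lambda>i j. 1) H \<and>
    (\<forall>k. (\<forall>i\<in>{1..m}. card (H i) = k) \<longrightarrow> nondisjoint_PSEDF G (order G) m k 1 H) \<and>
    (\<exists>l. classical_GEDF G (order G) m (\<lambda>i. card (H i - {\<one>\<^bsub>G\<^esub>})) l (\<lambda>i. H i - {\<one>\<^bsub>G\<^esub>})) \<and>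
    (\<forall>k. (\<forall>i\<in>{1..m}. card (H i) = k) \<longrightarrow>
       (\<exists>l. classical_EDF G (order G) m (k - 1) l (\<lambda>i. H i - {\<one>\<^bsub>G\<^esub>}))) \<and>
    ((\<forall>i\<in>{1..m}. H i \<noteq> {\<one>\<^bsub>G\<^esub>}) \<longrightarrow>
       \<not> (\<exists>v k l. classical_GSEDF G v m k l (\<lambda>i. H i - {\<one>\<^bsub>G\<^esub>})))"
proof -
  let ?H' = "\<lambda>i. H i - {\<one>\<^bsub>G\<^esub>}"
  interpret group G by fact
  note fin = assms(2) and sub = assms(4) and ord = assms(5)
  have carr: "H i \<subseteq> carrier G" if "i \<in> {1..m}" for i
    using sub[OF that] by (rule subgroup.subset)
  have one: "\<one>\<^bsub>G\<^esub> \<in> H i" if "i \<in> {1..m}" for i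
    using sub[OF that] by (rule subgroup.one_closed)
  have uniq: "\<exists>!i. i \<in> {1..m} \<and> g \<in> H i" if "g \<in> carrier G - {\<one>\<^bsub>G\<^esub>}" for g
    using assms(6) that unfolding group_partition_def by blast
  \<comment> \<open>A non-identity element of the intersection would belong to two members of the
    partition.\<close>
  have int: "H i \<inter> H j = {\<one>\<^bsub>G\<^esub>}" if "i \<in> {1..m}" "j \<in> {1..m}" "i \<noteq> j" for i j
    using uniq carr one that by blast
  have Delta_H: "Delta G (H i) (H j) = mset_set (carrier G)"
    if "i \<in> {1..m}" "j \<in> {1..m}" "i \<noteq> j" for i j
    using Delta_complementary_subgroups[OF fin sub sub int ord] that by blast
  have Delta_H': "Delta G (?H' i) (?H' j) = mset_set (carrier G - (H i \<union> H j))"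
    if "i \<in> {1..m}" "j \<in> {1..m}" "i \<noteq> j" for i j
    using Delta_complementary_subgroups_minus_one[OF fin sub sub int ord] that by blast

  have GPSEDF: "nondisjoint_GPSEDF G (order G) m (\<lambda>i. card (H i)) (\<lambda>i j. 1) H"
  proof -
    \<comment> \<open>The quotient is genuine: a finite group has positive order, so this is not
      division by zero.\<close>
    have "real 1 = real (card (H i)) * real (card (H j)) / real (order G)"
      if "i \<in> {1..m}" "j \<in> {1..m}" "i \<noteq> j" for i j
      using ord[OF that] order_gt_0_iff_finite fin
      by (metis div_self of_nat_1 of_nat_0_eq_iff of_nat_mult less_irrefl)
    moreover have "Delta G (H i) (H j) = repeat_mset 1 (mset_set (carrier G))"
      if "i \<in> {1..m}" "j \<in> {1..m}" "i \<noteq> j" for i j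
      using Delta_H[OF that] by simp
    ultimately show ?thesis
      unfolding nondisjoint_GPSEDF_def set_family_def
      using is_group fin carr by blast
  qed

  have PSEDF: "nondisjoint_PSEDF G (order G) m k 1 H" if "\<forall>i\<in>{1..m}. card (H i) = k" for k
    using GPSEDF that assms(3) by (simp add: nondisjoint_GPSEDF_def nondisjoint_PSEDF_def set_family_def)

  \<comment> \<open>Neither subtraction truncates, as \<open>m > 1\<close>. For \<open>m = 2\<close>
    the value 0 is right: a group that is the union of two subgroups equals one of them, so the
    order condition makes the other trivial and all differences vanish.\<close>
  let ?l = "(m - 1) * (m - 2)"
  have GEDF: "classical_GEDF G (order G) m (\<lambda>i. card (?H' i)) ?l ?H'"
  proof -
    let ?P = "{(i, j). i \<in> {1..m} \<and> j \<in> {1..m} \<and> i \<noteq> j}"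
    have finP: "finite ?P"
      by (rule finite_subset[of _ "{1..m} \<times> {1..m}"]) auto
    have "(\<Sum>(i, j)\<in>?P. Delta G (?H' i) (?H' j)) =
        (\<Sum>(i, j)\<in>?P. mset_set (carrier G - (H i \<union> H j)))"
      by (rule sum.cong) (auto simp: Delta_H')
    also have "\<dots> = repeat_mset ?l (mset_set (carrier G - {\<one>\<^bsub>G\<^esub>}))"
    proof (rule multiset_eqI)
      fix g
      \<comment> \<open>These are the index pairs whose summand contains \<open>g\<close>. Each
        summand comes from a set, so the multiplicity of \<open>g\<close> in the sum is the number
        of such pairs.\<close>
      let ?Q = "{(i, j). (i, j) \<in> ?P \<and> g \<in> carrier G - (H i \<union> H j)}"
      have "count (\<Sum>(i, j)\<in>?P. mset_set (carrier G - (H i \<union> H j))) g =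
          (\<Sum>(i, j)\<in>?P. if g \<in> carrier G - (H i \<union> H j) then 1 else 0)"
        using fin by (auto simp: count_sum count_mset_set' intro!: sum.cong)
      also have "\<dots> = card ?Q"
      proof -
        have "?Q = {p \<in> ?P. g \<in> carrier G - (H (fst p) \<union> H (snd p))}" by auto
        then show ?thesis
          using sum.inter_filter[OF finP, of "\<lambda>_. 1::nat"
              "\<lambda>p. g \<in> carrier G - (H (fst p) \<union> H (snd p))"]
          by (simp add: case_prod_unfold)
      qed
      also have "\<dots> = count (repeat_mset ?l (mset_set (carrier G - {\<one>\<^bsub>G\<^esub>}))) g"
      proof (cases "g \<in> carrier G - {\<one>\<^bsub>G\<^esub>}")
        case True
        then obtain r where r: "r \<in> {1..m}" "g \<in> H r"
          and r': "\<And>i. i \<in> {1..m} \<Longrightarrow> g \<in> H i \<Longrightarrow> i = r"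
          using uniq by blast
        \<comment> \<open>Since \<open>g\<close> lies in \<open>H r\<close> alone, avoiding
          \<open>H i \<union> H j\<close> means that \<open>i\<close> and \<open>j\<close> both
          differ from \<open>r\<close>, which leaves \<open>m - 1\<close> indices.\<close>
        have "?Q = {(i, j). i \<in> {1..m} - {r} \<and> j \<in> {1..m} - {r} \<and> i \<noteq> j}"
          using r r' True by blast
        then have "card ?Q = ?l"
          using r by (simp only: card_off_diagonal[OF finite_Diff[OF finite_atLeastAtMost]])
            (simp add: numeral_2_eq_2)
        then show ?thesis using True fin by (simp add: count_mset_set')
      next
        case False
        \<comment> \<open>Here \<open>g\<close> is either outside the group or the identity, and the
          identity lies in every \<open>H i\<close>.\<close>
        then have Q: "?Q = {}" using one by auto
        show ?thesis unfolding Q using False by (auto simp: count_mset_set')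
      qed
      finally show "count (\<Sum>(i, j)\<in>?P. mset_set (carrier G - (H i \<union> H j))) g =
          count (repeat_mset ?l (mset_set (carrier G - {\<one>\<^bsub>G\<^esub>}))) g" .
    qed
    finally show ?thesis
      using is_group fin carr int
      unfolding classical_GEDF_def set_family_def disjoint_family_on_def by blast
  qed

  have EDF: "classical_EDF G (order G) m (k - 1) ?l ?H'" if k: "\<forall>i\<in>{1..m}. card (H i) = k" for k
  proof -
    have "card (?H' i) = k - 1" if "i \<in> {1..m}" for i
      using k one[OF that] that by simp
    then show ?thesis
      using GEDF assms(3) by (simp add: classical_EDF_def classical_GEDF_def set_family_def)
  qed

  \<comment> \<open>Nontriviality excludes a degenerate case: for \<open>m = 2\<close> with
    \<open>H 1\<close> the whole group and \<open>H 2\<close> trivial, all differences are empty and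
    the family is a GSEDF with every \<open>l i = 0\<close>.\<close>
  have not_GSEDF: "\<not> classical_GSEDF G v m k l ?H'"
    if nontriv: "\<forall>i\<in>{1..m}. H i \<noteq> {\<one>\<^bsub>G\<^esub>}" for v k l
  proof
    assume "classical_GSEDF G v m k l ?H'"
    then have eq: "(\<Sum>j\<in>{1..m} - {1}. Delta G (?H' 1) (?H' j)) =
        repeat_mset (l 1) (mset_set (carrier G - {\<one>\<^bsub>G\<^esub>}))"
      using assms(3) by (simp add: classical_GSEDF_def)
    have idx: "1 \<in> {1..m}" "2 \<in> {1..m}" using assms(3) by auto
    obtain a where a: "a \<in> H 1" "a \<noteq> \<one>\<^bsub>G\<^esub>" using nontriv one idx(1) by blast
    obtain b where b: "b \<in> H 2" "b \<noteq> \<one>\<^bsub>G\<^esub>" using nontriv one idx(2) by blast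
    have "count (\<Sum>j\<in>{1..m} - {1}. Delta G (?H' 1) (?H' j)) a = 0"
      unfolding count_sum
    proof (rule sum.neutral, rule ballI)
      fix j assume "j \<in> {1..m} - {1}"
      then show "count (Delta G (?H' 1) (?H' j)) a = 0"
        using Delta_H'[of 1 j] idx a by (simp add: count_mset_set')
    qed
    moreover have "a \<in> carrier G - {\<one>\<^bsub>G\<^esub>}" using a carr idx by blast
    \<comment> \<open>The multiplicity of \<open>a\<close> is 0 on the left and \<open>l 1\<close>
      on the right, so the whole sum for index 1 must be empty.\<close>
    ultimately have "l 1 = 0" unfolding eq using fin by (simp add: count_mset_set')
    with eq have "\<forall>j\<in>{1..m} - {1}. Delta G (?H' 1) (?H' j) = {#}"
      by (simp add: sum_eq_empty_iff)
    then have "Delta G (?H' 1) (?H' 2) = {#}" using idx by simp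
    \<comment> \<open>Finiteness matters because \<open>mset_set\<close> of an infinite set is also
      empty; only now does an empty multiset yield an empty product, which the pair
      \<open>(a, b)\<close> refutes.\<close>
    moreover have "finite (?H' 1 \<times> ?H' 2)"
      using finite_subset[OF carr fin] idx by blast
    ultimately have "?H' 1 \<times> ?H' 2 = {}"
      by (simp add: Delta_def mset_set_empty_iff del: Times_empty)
    with a b show False by blast
  qed

  show ?thesis using GPSEDF PSEDF GEDF EDF not_GSEDF by blast
qed

end
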